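(* Suppose Assumptions A1, A3, A4 and B1 hold. Let $\{w_k\}$ be generated by the inexact subsampled Newton-CG method $w_{k+1}=w_k+p_k^r$, where $p_k^r$ is the result of $r$ conjugate gradient iterations, started from $p^0=0$, applied to $\nabla^2R_{S_k}(w_k)p=-\nabla R(w_k)$, with $$|S_k|=\beta\ge\frac{64\sigma^2}{\bar\mu^2}$$ for all $k$, and with $\delta(\beta)=L_\beta/\mu_\beta>1$ and $$r\ge\log\left(\frac{16L}{\mu_\beta}\sqrt{\delta(\beta)}\right)\Big/\log\left(\frac{\sqrt{\delta(\beta)}+1}{\sqrt{\delta(\beta)}-1}\right).$$ If $\|w_0-w^*\|\le\min\left\{\frac1{4C_1},\frac1{4\gamma C_1}\right\}$ with $C_1=\frac{M}{2\mu_\beta}$, then for all $k\ge0$, $$\mathbb{E}[\|w_{k+1}-w^*\|]\le\tfrac12\,\mathbb{E}[\|w_k-w^*\|].$$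
   Context: Setting (finite sum): $R(w)=\frac1N\sum_{i=1}^NF_i(w)$ for $w\in\mathbb{R}^d$, each $F_i$ twice continuously differentiable. For an index multiset $S$, $\nabla^2R_S(w)=\frac1{|S|}\sum_{i\in S}\nabla^2F_i(w)$. At each iteration $S_k$ consists of $\beta$ indices drawn independently and uniformly from $\{1,\dots,N\}$, independent of the past; the full gradient $\nabla R(w_k)$ is used. $w^*$ is the unique minimizer of $R$. Assumption A1 (for $R$): for every positive integer $\beta$ there are $0<\mu_\beta\le L_\beta$ with $\mu_\beta I\preceq\nabla^2R_S(w)\preceq L_\beta I$ for all $w$ and all $|S|=\beta$; constants $0<\bar\mu\le\mu_\beta$, $L_\beta\le\bar L<\infty$ for all $\beta$; and $\mu I\preceq\nabla^2R(w)\preceq LI$ for all $w$. Assumption A3: $\|\nabla^2R(w)-\nabla^2R(z)\|\le M\|w-z\|$ for all $w,z$. Assumption A4: with $i$ uniform on $\{1,\dots,N\}$, $\|\mathbb{E}[(\nabla^2F_i(w)-\nabla^2R(w))^2]\|\le\sigma^2$ for all $w$. Assumption B1: there is $\gamma>0$ such that every iterate satisfies $\mathbb{E}[\|w_k-w^*\|^2]\le\gamma(\mathbb{E}[\|w_k-w^*\|])^2$. *)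

theory Defs
  imports "HOL-Analysis.Analysis" "HOL-Probability.Probability"
begin

text \<open>Finite-sum objective over indices 0..N-1 (the paper's 1..N, shifted).\<close>

definition R_avg :: "(nat \<Rightarrow> real^'n \<Rightarrow> real) \<Rightarrow> nat \<Rightarrow> real^'n \<Rightarrow> real" where
  "R_avg F N w = (1 / real N) * (\<Sum>i<N. F i w)"

definition grad_avg :: "(nat \<Rightarrow> real^'n \<Rightarrow> real^'n) \<Rightarrow> nat \<Rightarrow> real^'n \<Rightarrow> real^'n" where
  "grad_avg G N w = (1 / real N) *\<^sub>R (\<Sum>i<N. G i w)"

definition hess_avg :: "(nat \<Rightarrow> real^'n \<Rightarrow> real^'n^'n) \<Rightarrow> nat \<Rightarrow> real^'n \<Rightarrow> real^'n^'n" where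
  "hess_avg H N w = (1 / real N) *\<^sub>R (\<Sum>i<N. H i w)"

text \<open>Subsampled Hessian for an index multiset S, given as a list (draws with repetition).\<close>
definition hess_sub :: "(nat \<Rightarrow> real^'n \<Rightarrow> real^'n^'n) \<Rightarrow> nat list \<Rightarrow> real^'n \<Rightarrow> real^'n^'n" where
  "hess_sub H S w = (1 / real (length S)) *\<^sub>R (\<Sum>i\<leftarrow>S. H i w)"

definition loewner_between :: "real \<Rightarrow> real^'n^'n \<Rightarrow> real \<Rightarrow> bool" where
  "loewner_between lo A hi \<longleftrightarrow>
     (\<forall>v. lo * (v \<bullet> v) \<le> v \<bullet> (A *v v) \<and> v \<bullet> (A *v v) \<le> hi * (v \<bullet> v))"

definition matnorm :: "real^'n^'n \<Rightarrow> real" where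
  "matnorm A = onorm (\<lambda>x. A *v x)"

fun cg_state :: "real^'n^'n \<Rightarrow> real^'n \<Rightarrow> nat \<Rightarrow> (real^'n) \<times> (real^'n) \<times> (real^'n)" where
  "cg_state A b 0 = (0, b, b)"
| "cg_state A b (Suc k) =
    (let (p, res, d) = cg_state A b k;
         \<alpha> = (res \<bullet> res) / (d \<bullet> (A *v d));
         p' = p + \<alpha> *\<^sub>R d;
         res' = res - \<alpha> *\<^sub>R (A *v d);
         bt = (res' \<bullet> res') / (res \<bullet> res);
         d' = res' + bt *\<^sub>R d
     in (p', res', d'))"

definition cg :: "real^'n^'n \<Rightarrow> real^'n \<Rightarrow> nat \<Rightarrow> real^'n" where
  "cg A b r = fst (cg_state A b r)"

definition SN_step :: "(nat \<Rightarrow> real^'n \<Rightarrow> real^'n) \<Rightarrow> (nat \<Rightarrow> real^'n \<Rightarrow> real^'n^'n) \<Rightarrow> nat \<Rightarrow> nat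
    \<Rightarrow> nat list \<Rightarrow> real^'n \<Rightarrow> real^'n" where
  "SN_step G H N r S w = w + cg (hess_sub H S w) (- grad_avg G N w) r"

definition SN_iter :: "(nat \<Rightarrow> real^'n \<Rightarrow> real^'n) \<Rightarrow> (nat \<Rightarrow> real^'n \<Rightarrow> real^'n^'n) \<Rightarrow> nat \<Rightarrow> nat
    \<Rightarrow> real^'n \<Rightarrow> nat list list \<Rightarrow> real^'n" where
  "SN_iter G H N r w0 ss = foldl (\<lambda>w S. SN_step G H N r S w) w0 ss"

text \<open>All possible sample histories of k iterations, each S_j consisting of beta
  indices from {0..<N}; independent uniform draws = uniform distribution on this set.\<close>
definition samples :: "nat \<Rightarrow> nat \<Rightarrow> nat \<Rightarrow> nat list list set" where
  "samples N beta k = {ss. length ss = k \<and> (\<forall>S\<in>set ss. length S = beta \<and> set S \<subseteq> {..<N})}"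

definition sample_expect :: "nat \<Rightarrow> nat \<Rightarrow> nat \<Rightarrow> (nat list list \<Rightarrow> real) \<Rightarrow> real" where
  "sample_expect N beta k f = measure_pmf.expectation (pmf_of_set (samples N beta k)) f"

end

theory Submission
  imports Defs
begin

text \<open>
  With $v = w_k - w^*$ and $A = \nabla^2 R_{S_k}(w_k)$, the next error is
  $A^{-1}(A - \nabla^2 R)v + A^{-1}(\nabla^2 R\, v - \nabla R) + (p_k^r + A^{-1}\nabla R)$.
  The first term has mean at most $\sigma\|v\| / (\mu_\beta\sqrt\beta) \le \|v\|/8$, because the
  variance of an average of $\beta$ independent draws is $1/\beta$ times that of one draw. The second is at most
  $C_1\|v\|^2$ by the Lipschitz continuity of the Hessian, and the third at most $\|v\|/8$ by the
  convergence rate of conjugate gradients. Hence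
  $E_{k+1} \le C_1\gamma E_k^2 + E_k/4$ for $E_k = \mathbf{E}\|w_k - w^*\|$, and
  $C_1\gamma E_k \le 1/4$ propagates from $k = 0$.

  The conjugate gradient rate needs no spectral theorem: the bound $\|T_n(B)e\| \le \|e\|$ for
  $-I \preceq B \preceq I$ follows from the Pell identity $T_n^2 + (1 - x^2)U_{n-1}^2 = 1$.
\<close>

subsection \<open>Symmetric matrices\<close>

text \<open>Phrased through the bilinear form, because symmetry serves to move \<open>A\<close>
  across an inner product. \<open>loewner_between\<close> constrains the quadratic form alone and
  does not imply it.\<close>

definition sym_mat :: "real^'n^'n \<Rightarrow> bool" where
  "sym_mat A \<longleftrightarrow> (\<forall>x y. x \<bullet> (A *v y) = y \<bullet> (A *v x))"

lemma sym_matD: "sym_mat A \<Longrightarrow> x \<bullet> (A *v y) = y \<bullet> (A *v x)"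
  by (simp add: sym_mat_def)

lemma sym_mat_0: "sym_mat 0"
  by (simp add: sym_mat_def)

lemma sym_mat_add: "sym_mat A \<Longrightarrow> sym_mat B \<Longrightarrow> sym_mat (A + B)"
  by (simp add: sym_mat_def matrix_vector_mult_add_rdistrib inner_add_right)

lemma sym_mat_diff: "sym_mat A \<Longrightarrow> sym_mat B \<Longrightarrow> sym_mat (A - B)"
  by (simp add: sym_mat_def matrix_vector_mult_diff_rdistrib inner_diff_right)

lemma sym_mat_scaleR: "sym_mat A \<Longrightarrow> sym_mat (c *\<^sub>R A)"
  by (simp add: sym_mat_def scaleR_matrix_vector_assoc[symmetric])

lemma sym_mat_sum: "(\<And>i. i \<in> I \<Longrightarrow> sym_mat (A i)) \<Longrightarrow> sym_mat (sum A I)"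
  by (induction I rule: infinite_finite_induct) (auto intro: sym_mat_0 sym_mat_add)

lemma sym_mat_sum_list: "(\<And>i. i \<in> set S \<Longrightarrow> sym_mat (A i)) \<Longrightarrow> sym_mat (\<Sum>i\<leftarrow>S. A i)"
  by (induction S) (auto intro: sym_mat_0 sym_mat_add)

lemma sum_matrix_vector_mult: "sum A I *v (x :: real^'n) = (\<Sum>i\<in>I. A i *v x)"
  by (induction I rule: infinite_finite_induct) (auto simp: matrix_vector_mult_add_rdistrib)

lemma sum_list_matrix_vector_mult: "(\<Sum>i\<leftarrow>S. A i) *v (x :: real^'n) = (\<Sum>i\<leftarrow>S. A i *v x)"
  by (induction S) (auto simp: matrix_vector_mult_add_rdistrib)

lemma norm_le_matnorm: "norm (A *v x) \<le> matnorm A * norm x"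
  unfolding matnorm_def by (rule onorm) (rule matrix_vector_mul_bounded_linear)

text \<open>Discriminant argument on the combinations of \<open>x\<close> and \<open>y\<close>. The
  form may be degenerate, so \<open>c = 0\<close> is a separate case.\<close>

lemma psd_Cauchy_Schwarz:
  fixes A :: "real^'n^'n"
  assumes "sym_mat A" and psd: "\<And>v. 0 \<le> v \<bullet> (A *v v)"
  shows "(x \<bullet> (A *v y))\<^sup>2 \<le> (x \<bullet> (A *v x)) * (y \<bullet> (A *v y))"
proof -
  define a b c where "a = x \<bullet> (A *v x)" and "b = x \<bullet> (A *v y)" and "c = y \<bullet> (A *v y)"
  have q: "0 \<le> s\<^sup>2 * a + 2 * s * t * b + t\<^sup>2 * c" for s t
  proof -
    have "(s *\<^sub>R x + t *\<^sub>R y) \<bullet> (A *v (s *\<^sub>R x + t *\<^sub>R y)) = s\<^sup>2 * a + 2 * s * t * b + t\<^sup>2 * c"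
      using sym_matD[OF assms(1), of y x]
      by (simp add: a_def b_def c_def matrix_vector_right_distrib matrix_vector_mult_scaleR
          inner_add_left inner_add_right power2_eq_square algebra_simps)
    then show ?thesis using psd by metis
  qed
  have a: "0 \<le> a" and c: "0 \<le> c" using psd by (auto simp: a_def c_def)
  have "b\<^sup>2 \<le> a * c"
  proof (cases "c = 0")
    \<comment> \<open>At \<open>s = - b\<close>, \<open>t = a + 1\<close> the quadratic equals
      \<open>- b\<^sup>2 * (a + 2)\<close>, which forces \<open>b = 0\<close>.\<close>
    case True
    have "b\<^sup>2 * (a + 2) \<le> 0"
      using q[of "- b" "a + 1"] True by (simp add: power2_eq_square algebra_simps)
    then have "b\<^sup>2 = 0" using a by (smt (verit) mult_pos_pos zero_le_power2)
    then show ?thesis using True by simp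
  next
    case False
    then have "c > 0" using c by simp
    have "0 \<le> c * (c * a - b\<^sup>2)"
      using q[of c "- b"] by (simp add: power2_eq_square algebra_simps)
    then show ?thesis using \<open>c > 0\<close> by (simp add: zero_le_mult_iff mult.commute)
  qed
  then show ?thesis by (simp add: a_def b_def c_def)
qed

text \<open>The operator inequality A^2 <= L A, obtained without a square root of \<open>A\<close>:
  Cauchy-Schwarz for the form of \<open>A\<close>, applied to \<open>u\<close> and
  \<open>A *v u\<close>, leaves one factor |Au|^2 to cancel.\<close>

lemma sym_bounded_norm_image_sq_le:
  fixes A :: "real^'n^'n"
  assumes sym: "sym_mat A" and psd: "\<And>v. 0 \<le> v \<bullet> (A *v v)"
    and up: "\<And>v. v \<bullet> (A *v v) \<le> L * (v \<bullet> v)"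
  shows "(A *v u) \<bullet> (A *v u) \<le> L * (u \<bullet> (A *v u))"
proof (cases "A *v u = 0")
  case True then show ?thesis using psd by simp
next
  case False
  define n where "n = (A *v u) \<bullet> (A *v u)"
  have n: "n > 0" using False by (simp add: n_def)
  have "n\<^sup>2 = (u \<bullet> (A *v (A *v u)))\<^sup>2"
    using sym_matD[OF sym, of u "A *v u"] by (simp add: n_def)
  also have "\<dots> \<le> (u \<bullet> (A *v u)) * ((A *v u) \<bullet> (A *v (A *v u)))"
    by (rule psd_Cauchy_Schwarz[OF sym psd])
  also have "\<dots> \<le> (u \<bullet> (A *v u)) * (L * n)"
    unfolding n_def by (intro mult_left_mono up psd)
  finally have "n * n \<le> n * (L * (u \<bullet> (A *v u)))" by (simp add: power2_eq_square algebra_simps)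
  then have "n \<le> L * (u \<bullet> (A *v u))" using n by simp
  then show ?thesis by (simp add: n_def)
qed

lemma coercive_norm_image_ge:
  fixes A :: "real^'n^'n"
  assumes lo: "\<And>v. m * (v \<bullet> v) \<le> v \<bullet> (A *v v)"
  shows "m * norm u \<le> norm (A *v u)"
proof (cases "u = 0")
  case False
  have "norm u * (m * norm u) = m * (u \<bullet> u)" by (simp add: dot_square_norm power2_eq_square)
  also have "\<dots> \<le> norm u * norm (A *v u)" using lo norm_cauchy_schwarz order_trans by blast
  finally show ?thesis using False by simp
qed simp

text \<open>The counterpart m A <= A^2: combine <u, Au> <= |u| |Au| with m |u| <= |Au|.\<close>

lemma coercive_norm_image_sq_ge:
  fixes A :: "real^'n^'n"
  assumes lo: "\<And>v. m * (v \<bullet> v) \<le> v \<bullet> (A *v v)" and "m > 0"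
  shows "m * (u \<bullet> (A *v u)) \<le> (A *v u) \<bullet> (A *v u)"
proof -
  have "m * (u \<bullet> (A *v u)) \<le> m * (norm u * norm (A *v u))"
    using \<open>m > 0\<close> norm_cauchy_schwarz by simp
  also have "\<dots> = (m * norm u) * norm (A *v u)" by simp
  also have "\<dots> \<le> norm (A *v u) * norm (A *v u)"
    by (intro mult_right_mono coercive_norm_image_ge lo) simp
  finally show ?thesis by (simp add: dot_square_norm power2_eq_square)
qed

lemma sym_bounded_norm_image_le:
  fixes A :: "real^'n^'n"
  assumes "sym_mat A" "\<And>v. 0 \<le> v \<bullet> (A *v v)" "\<And>v. v \<bullet> (A *v v) \<le> L * (v \<bullet> v)" "L \<ge> 0"
  shows "norm (A *v u) \<le> L * norm u"
proof -
  have "(A *v u) \<bullet> (A *v u) \<le> L * (L * (u \<bullet> u))"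
    using sym_bounded_norm_image_sq_le[OF assms(1-3), of u] assms(3)[of u] assms(4)
    by (meson mult_left_mono order_trans)
  then have "(norm (A *v u))\<^sup>2 \<le> (L * norm u)\<^sup>2"
    by (simp add: dot_square_norm power2_eq_square algebra_simps)
  then show ?thesis by (rule power2_le_imp_le) (simp add: assms(4))
qed

subsection \<open>Conjugate gradients\<close>

text \<open>The span of b, Ab, ..., A^(n-1) b, that is, all p(A) b with deg p < n. The recursion is
  Horner's scheme, so multiplication by \<open>A\<close> raises the index by one by
  construction.\<close>

fun krylov :: "real^'n^'n \<Rightarrow> real^'n \<Rightarrow> nat \<Rightarrow> (real^'n) set" where
  "krylov A b 0 = {0}"
| "krylov A b (Suc n) = {c *\<^sub>R b + A *v v |c v. v \<in> krylov A b n}"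

lemma krylov_SucI: "v \<in> krylov A b n \<Longrightarrow> c *\<^sub>R b + A *v v \<in> krylov A b (Suc n)"
  by auto

lemma subspace_krylov: "subspace (krylov A b n)"
proof (induction n)
  case 0 then show ?case by (simp add: subspace_def)
next
  case (Suc n)
  show ?case
  proof (rule subspaceI)
    show "0 \<in> krylov A b (Suc n)"
      using krylov_SucI[OF subspace_0[OF Suc], of 0] by simp
  next
    fix x y assume "x \<in> krylov A b (Suc n)" "y \<in> krylov A b (Suc n)"
    then obtain c v c' v' where "x = c *\<^sub>R b + A *v v" "v \<in> krylov A b n"
      "y = c' *\<^sub>R b + A *v v'" "v' \<in> krylov A b n" by auto
    then show "x + y \<in> krylov A b (Suc n)"
      using krylov_SucI[OF subspace_add[OF Suc, of v v'], of "c + c'"]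
      by (simp add: matrix_vector_right_distrib algebra_simps del: krylov.simps)
  next
    fix s x assume "x \<in> krylov A b (Suc n)"
    then obtain c v where "x = c *\<^sub>R b + A *v v" "v \<in> krylov A b n" by auto
    then show "s *\<^sub>R x \<in> krylov A b (Suc n)"
      using krylov_SucI[OF subspace_scale[OF Suc, of v s], of "s * c"]
      by (simp add: matrix_vector_mult_scaleR scaleR_right_distrib del: krylov.simps)
  qed
qed

lemmas krylov_add = subspace_add[OF subspace_krylov]
lemmas krylov_diff = subspace_diff[OF subspace_krylov]
lemmas krylov_scale = subspace_scale[OF subspace_krylov]
lemmas krylov_0 = subspace_0[OF subspace_krylov]

lemma krylov_base: "b \<in> krylov A b (Suc n)"
  using krylov_SucI[OF krylov_0, of 1 b A n] by simp

lemma krylov_image: "v \<in> krylov A b n \<Longrightarrow> A *v v \<in> krylov A b (Suc n)"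
  using krylov_SucI[of v A b n 0] by simp

lemma krylov_Suc: "v \<in> krylov A b n \<Longrightarrow> v \<in> krylov A b (Suc n)"
proof (induction n arbitrary: v)
  case 0 then show ?case using krylov_0[of A b "Suc 0"] by simp
next
  case (Suc n)
  then obtain c u where "v = c *\<^sub>R b + A *v u" "u \<in> krylov A b n" by auto
  then show ?case
    using krylov_SucI[OF Suc.IH, of u c] by simp
qed

text \<open>
  Once the residual vanishes, \<open>0 / 0 = 0\<close> makes both step lengths zero and the iteration stalls at
  the solution, so the properties of the direction \<open>d\<close> are only needed for \<open>res \<noteq> 0\<close>.
\<close>

lemma cg_invariants:
  fixes A :: "real^'n^'n"
  assumes sym: "sym_mat A" and pd: "\<And>v. v \<noteq> 0 \<Longrightarrow> 0 < v \<bullet> (A *v v)"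
  assumes "cg_state A b k = (p, res, d)"
  shows "p \<in> krylov A b k \<and> res = b - A *v p \<and> (\<forall>v\<in>krylov A b k. res \<bullet> v = 0) \<and>
     (res \<noteq> 0 \<longrightarrow> d \<in> krylov A b (Suc k) \<and> d - res \<in> krylov A b k \<and>
        (\<forall>v\<in>krylov A b k. d \<bullet> (A *v v) = 0) \<and>
        (\<forall>v\<in>krylov A b (Suc k). \<exists>u\<in>krylov A b k. \<exists>c. v = u + c *\<^sub>R d))"
  using assms(3)
proof (induction k arbitrary: p res d)
  case 0
  then show ?case using krylov_base[of b A 0] by auto
next
  case (Suc k)
  let ?K = "krylov A b"
  obtain p0 r0 d0 where st: "cg_state A b k = (p0, r0, d0)" by (metis prod_cases3)
  define \<alpha> where "\<alpha> = (r0 \<bullet> r0) / (d0 \<bullet> (A *v d0))"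
  define bt where "bt = (res \<bullet> res) / (r0 \<bullet> r0)"
  have p: "p = p0 + \<alpha> *\<^sub>R d0" and res: "res = r0 - \<alpha> *\<^sub>R (A *v d0)"
    and d: "d = res + bt *\<^sub>R d0"
    using Suc.prems by (auto simp: st Let_def \<alpha>_def bt_def)
  note IH = Suc.IH[OF st]
  have p0: "p0 \<in> ?K k" and r0: "r0 = b - A *v p0" using IH by auto
  have orth0: "r0 \<bullet> v = 0" if "v \<in> ?K k" for v using IH that by auto
  have resA: "res = b - A *v p"
    by (simp add: res r0 p matrix_vector_right_distrib matrix_vector_mult_scaleR)
  show ?case
  proof (cases "r0 = 0")
    case True
    then have "\<alpha> = 0" by (simp add: \<alpha>_def)
    then have "p = p0" "res = 0" using p res True by auto
    then show ?thesis using resA krylov_Suc[OF p0] by (simp del: krylov.simps)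
  next
    case False
    then have d0K: "d0 \<in> ?K (Suc k)" and dr: "d0 - r0 \<in> ?K k"
      and conj0: "\<And>v. v \<in> ?K k \<Longrightarrow> d0 \<bullet> (A *v v) = 0"
      and dec: "\<And>v. v \<in> ?K (Suc k) \<Longrightarrow> \<exists>u\<in>?K k. \<exists>c. v = u + c *\<^sub>R d0"
      using IH by blast+
    \<comment> \<open>The direction differs from the residual by an element of the Krylov space to
      which the residual is orthogonal.\<close>
    have rd: "r0 \<bullet> d0 = r0 \<bullet> r0" using orth0[OF dr] by (simp add: inner_diff_right)
    have "d0 \<noteq> 0" using rd False by auto
    then have dAd: "0 < d0 \<bullet> (A *v d0)" by (rule pd)
    have rr: "0 < r0 \<bullet> r0" using False by simp
    have \<alpha>: "\<alpha> > 0" unfolding \<alpha>_def using dAd rr by simp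
    have \<alpha>d: "\<alpha> * (d0 \<bullet> (A *v d0)) = r0 \<bullet> r0" using dAd by (simp add: \<alpha>_def)
    have pK: "p \<in> ?K (Suc k)" unfolding p by (rule krylov_add[OF krylov_Suc[OF p0] krylov_scale[OF d0K]])
    have r0K: "r0 \<in> ?K (Suc k)"
      using krylov_diff[OF d0K krylov_Suc[OF dr]] by simp
    \<comment> \<open>The new Krylov space is the old one plus the line of \<open>d0\<close>.
      Conjugacy of \<open>d0\<close> handles the first part, the choice of \<open>\<alpha>\<close>
      the second.\<close>
    have orth: "res \<bullet> v = 0" if v: "v \<in> ?K (Suc k)" for v
    proof -
      obtain u c where u: "u \<in> ?K k" "v = u + c *\<^sub>R d0" using dec[OF v] by blast
      have "res \<bullet> u = 0"
        using orth0[OF u(1)] conj0[OF u(1)] sym_matD[OF sym, of d0 u]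
        by (simp add: res inner_diff_left inner_commute[of "A *v d0"])
      moreover have "res \<bullet> d0 = 0"
        using rd \<alpha>d by (simp add: res inner_diff_left inner_commute[of "A *v d0"])
      ultimately show ?thesis by (simp add: u inner_add_right)
    qed
    have Ad0: "A *v d0 = (1 / \<alpha>) *\<^sub>R (r0 - res)" using \<alpha> by (simp add: res)
    have resK: "res \<in> ?K (Suc (Suc k))"
      unfolding resA by (intro krylov_diff krylov_base krylov_image pK)
    have dK: "d \<in> ?K (Suc (Suc k))"
      unfolding d by (intro krylov_add resK krylov_scale krylov_Suc[OF d0K])
    have ddr: "d - res \<in> ?K (Suc k)"
      by (simp add: d krylov_scale d0K del: krylov.simps)
    have conj: "d \<bullet> (A *v v) = 0" if v: "v \<in> ?K (Suc k)" for v
    proof -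
      obtain u c where u: "u \<in> ?K k" "v = u + c *\<^sub>R d0" using dec[OF v] by blast
      have "d \<bullet> (A *v u) = 0"
        using orth[OF krylov_image[OF u(1)]] conj0[OF u(1)] by (simp add: d inner_add_left)
      \<comment> \<open>The choice of \<open>bt\<close> makes the two contributions cancel, since
        \<open>res\<close> is already orthogonal to \<open>r0\<close>.\<close>
      moreover have "d \<bullet> (A *v d0) = 0"
      proof -
        have "res \<bullet> (A *v d0) = - (res \<bullet> res) / \<alpha>"
          unfolding Ad0 using orth[OF r0K] by (simp add: inner_diff_right)
        moreover have "bt * (d0 \<bullet> (A *v d0)) = (res \<bullet> res) / \<alpha>"
          unfolding bt_def \<alpha>_def using rr by simp
        ultimately show ?thesis by (simp add: d inner_add_left)
      qed
      ultimately show ?thesis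
        by (simp add: u matrix_vector_right_distrib matrix_vector_mult_scaleR inner_add_right)
    qed
    have "\<exists>u\<in>?K (Suc k). \<exists>c. v = u + c *\<^sub>R d" if v: "v \<in> ?K (Suc (Suc k))" for v
    proof -
      obtain c x where x: "v = c *\<^sub>R b + A *v x" "x \<in> ?K (Suc k)"
        using v unfolding krylov.simps(2)[of A b "Suc k"] by blast
      obtain u e where u: "u \<in> ?K k" "x = u + e *\<^sub>R d0" using dec[OF x(2)] by blast
      \<comment> \<open>Substituting \<open>res = d - bt *\<^sub>R d0\<close> shows that
        \<open>A *v d0\<close> leaves the current Krylov space only along \<open>d\<close>.\<close>
      have "A *v d0 = (1 / \<alpha>) *\<^sub>R (r0 + bt *\<^sub>R d0) - (1 / \<alpha>) *\<^sub>R d"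
        unfolding Ad0 d by (simp add: algebra_simps)
      then have "v = (c *\<^sub>R b + A *v u + (e / \<alpha>) *\<^sub>R (r0 + bt *\<^sub>R d0)) + (- e / \<alpha>) *\<^sub>R d"
        by (simp add: x u matrix_vector_right_distrib matrix_vector_mult_scaleR scaleR_right_diff_distrib)
      moreover have "c *\<^sub>R b + A *v u + (e / \<alpha>) *\<^sub>R (r0 + bt *\<^sub>R d0) \<in> ?K (Suc k)"
        by (intro krylov_add krylov_scale krylov_base krylov_image u(1) r0K d0K)
      ultimately show ?thesis by blast
    qed
    then show ?thesis using pK resA orth dK ddr conj by blast
  qed
qed

text \<open>The residual is orthogonal to the Krylov space, so the error is
  \<open>A\<close>-orthogonal to it. Pythagoras in the energy norm then makes the iterate the best
  approximation of \<open>x\<close> in that space.\<close>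

lemma cg_optimal:
  fixes A :: "real^'n^'n"
  assumes sym: "sym_mat A" and pd: "\<And>v. v \<noteq> 0 \<Longrightarrow> 0 < v \<bullet> (A *v v)"
    and x: "A *v x = b" and y: "y \<in> krylov A b k"
  shows "(cg A b k - x) \<bullet> (A *v (cg A b k - x)) \<le> (y - x) \<bullet> (A *v (y - x))"
proof -
  obtain p res d where st: "cg_state A b k = (p, res, d)" by (metis prod_cases3)
  have p: "p \<in> krylov A b k" and res: "res = b - A *v p"
    and orth: "\<And>v. v \<in> krylov A b k \<Longrightarrow> res \<bullet> v = 0"
    using cg_invariants[OF sym pd st] by auto
  have cg: "cg A b k = p" by (simp add: cg_def st)
  define z where "z = y - p"
  have "A *v (p - x) = - res" by (simp add: matrix_vector_mult_diff_distrib x res)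
  moreover have "res \<bullet> z = 0" unfolding z_def by (intro orth krylov_diff y p)
  ultimately have z: "z \<bullet> (A *v (p - x)) = 0" by (simp add: inner_commute)
  have "0 \<le> z \<bullet> (A *v z)" using pd[of z] by (cases "z = 0") auto
  moreover have "y - x = (p - x) + z" by (simp add: z_def)
  then have "(y - x) \<bullet> (A *v (y - x)) = (p - x) \<bullet> (A *v (p - x)) + 2 * (z \<bullet> (A *v (p - x))) + z \<bullet> (A *v z)"
    using sym_matD[OF sym, of "p - x" z]
    by (simp only: matrix_vector_right_distrib inner_add_left inner_add_right)
  ultimately show ?thesis using z cg by simp
qed

section \<open>Chebyshev polynomials of an operator and the conjugate gradient rate\<close>

text \<open>
  The pair is $(T_n(B)e, U_{n-1}(B)e)$ with the Chebyshev polynomials of both kinds and $U_{-1} = 0$.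
\<close>

fun cheb_pair :: "('a::ab_group_add \<Rightarrow> 'a) \<Rightarrow> 'a \<Rightarrow> nat \<Rightarrow> 'a \<times> 'a" where
  "cheb_pair B e 0 = (e, 0)"
| "cheb_pair B e (Suc n) = (let (t, u) = cheb_pair B e n in (B t - (u - B (B u)), t + B u))"

text \<open>The Pell identity read in a symmetric bilinear form \<open>q\<close> for which
  \<open>B\<close> is self-adjoint. It is invariant under T' = xT - (1 - x^2)U, U' = T + xU.\<close>

lemma cheb_pair_energy:
  fixes q :: "'a::real_vector \<Rightarrow> 'a \<Rightarrow> real"
  assumes q: "\<And>x y z. q x (y + z) = q x y + q x z" "\<And>x y z. q x (y - z) = q x y - q x z"
    and q_sym: "\<And>x y. q x y = q y x"
    and B: "linear B" and B_adj: "\<And>x y. q (B x) y = q x (B y)"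
    and "cheb_pair B e n = (t, u)"
  shows "q t t + q u (u - B (B u)) = q e e"
  using assms(6)
proof (induction n arbitrary: t u)
  case 0
  have "q 0 y = 0" for y using q(2)[of y 0 0] q_sym[of 0 y] by simp
  then show ?case using 0 by simp
next
  case (Suc n)
  obtain t0 u0 where st: "cheb_pair B e n = (t0, u0)" by (cases "cheb_pair B e n")
  have t: "t = B t0 - (u0 - B (B u0))" and u: "u = t0 + B u0" using Suc.prems st by auto
  have q': "q (x + y) z = q x z + q y z" "q (x - y) z = q x z - q y z" for x y z
    using q q_sym by metis+
  \<comment> \<open>Self-adjointness brings every mixed term to the shape q(t0, B^j u0). The mixed
    terms from the two squares, -2x(1 - x^2)TU and +2x(1 - x^2)TU, then cancel.\<close>
  have s: "q u0 t0 = q t0 u0" "q u0 (B t0) = q t0 (B u0)" "q u0 (B (B t0)) = q t0 (B (B u0))"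
    "q u0 (B (B (B t0))) = q t0 (B (B (B u0)))"
    using q_sym B_adj by metis+
  have "q t t + q u (u - B (B u)) = q t0 t0 + q u0 (u0 - B (B u0))"
    unfolding t u by (simp add: q q' s B_adj linear_add[OF B] linear_diff[OF B])
  then show ?case using Suc.IH[OF st] by simp
qed

text \<open>This makes the second summand of the energy identity nonnegative, which replaces the
  scalar fact |T_n| <= 1 on [-1, 1].\<close>

lemma contraction_of_form_bound:
  fixes q :: "'a::real_vector \<Rightarrow> 'a \<Rightarrow> real"
  assumes q: "\<And>x y z. q x (y + z) = q x y + q x z" "\<And>x y z. q x (y - z) = q x y - q x z"
    and q_sym: "\<And>x y. q x y = q y x"
    and B: "linear B" and B_adj: "\<And>x y. q (B x) y = q x (B y)"
    and bound: "\<And>x. \<bar>q x (B x)\<bar> \<le> q x x"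
  shows "0 \<le> q u (u - B (B u))"
proof -
  have q': "q (x + y) z = q x z + q y z" "q (x - y) z = q x z - q y z" for x y z
    using q q_sym by metis+
  \<comment> \<open>Operator form of $2(1-x^2) = (1+x)(1-x)^2 + (1-x)(1+x)^2$.\<close>
  have "2 * q u (u - B (B u)) =
      (q (u - B u) (u - B u) + q (u - B u) (B (u - B u))) +
      (q (u + B u) (u + B u) - q (u + B u) (B (u + B u)))"
    by (simp add: q q' B_adj linear_add[OF B] linear_diff[OF B])
  moreover have "0 \<le> q (u - B u) (u - B u) + q (u - B u) (B (u - B u))"
    "0 \<le> q (u + B u) (u + B u) - q (u + B u) (B (u + B u))"
    using bound[of "u - B u"] bound[of "u + B u"] by linarith+
  ultimately show ?thesis by linarith
qed

text \<open>The closed form of the Chebyshev polynomials at c = (z + 1/z)/2, with \<open>w\<close>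
  as 1/z. The factor \<open>z - w\<close> stays on the left to avoid a division; it enters through
  c^2 - 1 = ((z - w)/2)^2.\<close>

lemma cheb_pair_real:
  fixes z w :: real
  assumes "z * w = 1" and c: "c = (z + w) / 2" and "cheb_pair ((*) c) 1 n = (t, u)"
  shows "t = (z ^ n + w ^ n) / 2 \<and> (z - w) * u = z ^ n - w ^ n"
  using assms(3)
proof (induction n arbitrary: t u)
  case (Suc n)
  obtain t0 u0 where st: "cheb_pair ((*) c) 1 n = (t0, u0)" by (cases "cheb_pair ((*) c) 1 n")
  have t: "t = c * t0 - (u0 - c * (c * u0))" and u: "u = t0 + c * u0"
    using Suc.prems st by auto
  have IH: "t0 = (z ^ n + w ^ n) / 2" "(z - w) * u0 = z ^ n - w ^ n" using Suc.IH[OF st] by auto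
  have "c * c - 1 = (z - w) * (z - w) / 4" using assms(1) by (simp add: c field_simps)
  then have "t = c * t0 + (z - w) / 4 * ((z - w) * u0)" unfolding t by algebra
  then have "t = (z ^ Suc n + w ^ Suc n) / 2" unfolding IH by (simp add: c field_simps)
  moreover have "(z - w) * u = (z - w) * t0 + c * ((z - w) * u0)" unfolding u by algebra
  then have "(z - w) * u = z ^ Suc n - w ^ Suc n" unfolding IH by (simp add: c field_simps)
  ultimately show ?case by simp
qed auto

text \<open>As B = cI - sA, a polynomial f satisfies f(B)x = f(c)x + g(A)Ax with deg g < deg f, and
  Ax = b. The third clause treats U_n, which has degree n although it is the second component only
  at \<open>Suc n\<close>; it keeps the induction from losing an index.\<close>

lemma cheb_pair_krylov:
  fixes A :: "real^'n^'n"
  assumes Ax: "A *v x = b" and B: "\<And>v. B v = c *\<^sub>R v - s *\<^sub>R (A *v v)"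
    and "cheb_pair B x n = (t, u)" "cheb_pair ((*) c) 1 n = (t', u')"
  shows "t - t' *\<^sub>R x \<in> krylov A b n \<and> u - u' *\<^sub>R x \<in> krylov A b n \<and>
    (t + B u) - (t' + c * u') *\<^sub>R x \<in> krylov A b n"
  using assms(3,4)
proof (induction n arbitrary: t u t' u')
  case 0
  then show ?case by (auto simp: B)
next
  case (Suc n)
  let ?K = "krylov A b"
  have step: "B v - (c * a) *\<^sub>R x \<in> ?K (Suc m)" if v: "v - a *\<^sub>R x \<in> ?K m" for v a m
  proof -
    have "B v - (c * a) *\<^sub>R x = c *\<^sub>R (v - a *\<^sub>R x) - s *\<^sub>R (A *v (v - a *\<^sub>R x)) - (s * a) *\<^sub>R b"
      by (simp add: B Ax[symmetric] matrix_vector_mult_diff_distrib matrix_vector_mult_scaleR algebra_simps)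
    then show ?thesis
      using krylov_diff[OF krylov_diff[OF krylov_scale[OF krylov_Suc[OF v]]
          krylov_scale[OF krylov_image[OF v]]] krylov_scale[OF krylov_base]] by metis
  qed
  obtain t0 u0 where st: "cheb_pair B x n = (t0, u0)" by (cases "cheb_pair B x n")
  obtain t1 u1 where st': "cheb_pair ((*) c) 1 n = (t1, u1)" by (cases "cheb_pair ((*) c) 1 n")
  have t: "t = B t0 - (u0 - B (B u0))" and u: "u = t0 + B u0" using Suc.prems st by auto
  have t': "t' = c * t1 - (u1 - c * (c * u1))" and u': "u' = t1 + c * u1"
    using Suc.prems st' by auto
  note IH = Suc.IH[OF st st']
  have uK: "u - u' *\<^sub>R x \<in> ?K n" using IH by (simp add: u u')
  \<comment> \<open>T_(n+1) = x U_n - U_(n-1) applies \<open>B\<close> once to a quantity controlled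
    at index n, whereas the defining recurrence applies it twice.\<close>
  have "t - t' *\<^sub>R x = (B u - (c * u') *\<^sub>R x) - (u0 - u1 *\<^sub>R x)"
    by (simp add: t t' u u' B matrix_vector_right_distrib matrix_vector_mult_diff_distrib
        matrix_vector_mult_scaleR algebra_simps)
  then have tK: "t - t' *\<^sub>R x \<in> ?K (Suc n)"
    using krylov_diff[OF step[OF uK] krylov_Suc] IH by metis
  have "(t + B u) - (t' + c * u') *\<^sub>R x = (t - t' *\<^sub>R x) + (B u - (c * u') *\<^sub>R x)"
    by (simp add: algebra_simps)
  then have "(t + B u) - (t' + c * u') *\<^sub>R x \<in> ?K (Suc n)"
    using krylov_add[OF tK step[OF uK]] by metis
  then show ?case using tK krylov_Suc[OF uK] by blast
qed

text \<open>By optimality the iterate competes with any Krylov vector; the competitor chosen has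
  error -T_k(B)x / T_k(c). Its energy is at most that of \<open>x\<close> divided by T_k(c)^2, and
  T_k(c) is at least half the k-th power of the rate. Passing between energy and Euclidean norm
  costs the factor sqrt(L/m).\<close>

lemma cg_convergence:
  fixes A :: "real^'n^'n"
  assumes sym: "sym_mat A" and m: "0 < m" "m < L"
    and lo: "\<And>v. m * (v \<bullet> v) \<le> v \<bullet> (A *v v)" and up: "\<And>v. v \<bullet> (A *v v) \<le> L * (v \<bullet> v)"
    and Ax: "A *v x = b"
  shows "((sqrt (L / m) + 1) / (sqrt (L / m) - 1)) ^ k * norm (cg A b k - x)
    \<le> 2 * sqrt (L / m) * norm x"
proof -
  define \<kappa> where "\<kappa> = sqrt (L / m)"
  define z where "z = (\<kappa> + 1) / (\<kappa> - 1)"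
  define w where "w = (\<kappa> - 1) / (\<kappa> + 1)"
  \<comment> \<open>The affine map a -> c - s a sends \<open>m\<close> to 1, \<open>L\<close> to -1
    and 0 to \<open>c\<close>. Below, \<open>z\<close> and \<open>w\<close> are the reciprocal pair
    with mean \<open>c\<close>.\<close>
  define c where "c = (L + m) / (L - m)"
  define s where "s = 2 / (L - m)"
  define B where "B = (\<lambda>v. c *\<^sub>R v - s *\<^sub>R (A *v v))"
  define q where "q = (\<lambda>x y. x \<bullet> (A *v y))"
  define t where "t = fst (cheb_pair B x k)"
  define T where "T = fst (cheb_pair ((*) c) 1 k)"
  have \<kappa>: "\<kappa> > 1" using m by (simp add: \<kappa>_def)
  have L: "L = \<kappa>\<^sup>2 * m" using m by (simp add: \<kappa>_def)
  have zw: "z * w = 1" and z: "z > 0" and w: "w > 0" using \<kappa> by (auto simp: z_def w_def)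
  have c: "c = (z + w) / 2"
  proof -
    have "L + m = m * (\<kappa>\<^sup>2 + 1)" "L - m = m * (\<kappa>\<^sup>2 - 1)" by (simp_all add: L algebra_simps)
    then have "c = (\<kappa>\<^sup>2 + 1) / (\<kappa>\<^sup>2 - 1)" using m(1) by (simp add: c_def)
    moreover have "(\<kappa> - 1) * (\<kappa> + 1) = \<kappa>\<^sup>2 - 1" by (simp add: power2_eq_square algebra_simps)
    moreover have "(z + w) / 2 = (\<kappa>\<^sup>2 + 1) / ((\<kappa> - 1) * (\<kappa> + 1))"
    proof -
      have "z + w = ((\<kappa> + 1) * (\<kappa> + 1) + (\<kappa> - 1) * (\<kappa> - 1)) / ((\<kappa> - 1) * (\<kappa> + 1))"
        unfolding z_def w_def by (rule add_frac_eq) (use \<kappa> in auto)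
      moreover have "(\<kappa> + 1) * (\<kappa> + 1) + (\<kappa> - 1) * (\<kappa> - 1) = 2 * (\<kappa>\<^sup>2 + 1)"
        by (simp add: power2_eq_square algebra_simps)
      ultimately have "z + w = 2 * ((\<kappa>\<^sup>2 + 1) / ((\<kappa> - 1) * (\<kappa> + 1)))"
        by (simp only: times_divide_eq_right)
      then show ?thesis by (metis nonzero_mult_div_cancel_left zero_neq_numeral)
    qed
    ultimately show ?thesis by metis
  qed
  have T: "T = (z ^ k + w ^ k) / 2"
    using cheb_pair_real[OF zw c, of k] by (simp add: T_def prod_eq_iff)
  have Tz: "z ^ k \<le> 2 * T" and Tpos: "T > 0" using z w by (auto simp: T add_pos_pos)
  have psd: "0 \<le> v \<bullet> (A *v v)" for v
    using lo[of v] m by (meson inner_ge_zero mult_nonneg_nonneg order_trans less_imp_le)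
  have pd: "0 < v \<bullet> (A *v v)" if "v \<noteq> 0" for v
    using lo[of v] m that by (meson inner_gt_zero_iff mult_pos_pos order_less_le_trans)
  have linB: "linear B"
    unfolding B_def
    by (intro linear_compose_sub linear_compose_scale_right linear_ident matrix_vector_mul_linear)
  have q: "q x (y + z) = q x y + q x z" "q x (y - z) = q x y - q x z" "q x y = q y x" for x y z
    unfolding q_def using sym_matD[OF sym]
    by (auto simp: matrix_vector_right_distrib matrix_vector_mult_diff_distrib inner_add_right inner_diff_right)
  have qB: "q (B x) y = q x (B y)" for x y
    using sym_matD[OF sym, of x "A *v y"] inner_commute[of "A *v x" "A *v y"]
    by (simp add: q_def B_def matrix_vector_mult_diff_distrib matrix_vector_mult_scaleR
        inner_diff_left inner_diff_right)
  have bound: "\<bar>q v (B v)\<bar> \<le> q v v" for v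
  proof -
    \<comment> \<open>In terms of \<open>Q\<close> and \<open>P\<close>, the inequalities m A <= A^2
      <= L A are exactly the two halves of -1 <= B <= 1 in the form \<open>q\<close>.\<close>
    define Q where "Q = v \<bullet> (A *v v)"
    define P where "P = (A *v v) \<bullet> (A *v v)"
    have P: "P \<le> L * Q" "m * Q \<le> P"
      unfolding P_def Q_def
      using sym_bounded_norm_image_sq_le[OF sym psd up] coercive_norm_image_sq_ge[OF lo m(1)] by auto
    have "q v (B v) = c * Q - s * P"
      using sym_matD[OF sym, of v "A *v v"]
      by (simp add: q_def B_def Q_def P_def matrix_vector_mult_diff_distrib
          matrix_vector_mult_scaleR inner_diff_right)
    also have "\<dots> = ((L + m) * Q - 2 * P) / (L - m)" by (simp add: c_def s_def diff_divide_distrib)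
    finally have "(L - m) * q v (B v) = (L + m) * Q - 2 * P" using m by simp
    then have "(L - m) * q v (B v) \<le> (L - m) * Q" "(L - m) * (- Q) \<le> (L - m) * q v (B v)"
      using P by (simp_all add: algebra_simps)
    then have "q v (B v) \<le> Q" "- Q \<le> q v (B v)"
      using m by (simp_all only: mult_le_cancel_left_pos diff_gt_0_iff_gt)
    then show ?thesis by (simp add: abs_le_iff q_def Q_def)
  qed
  have "q t t \<le> q x x"
    using cheb_pair_energy[of q B x k, OF q linB qB] contraction_of_form_bound[of q B, OF q linB qB bound]
    unfolding t_def by (metis add.commute le_add_same_cancel2 prod.collapse)
  have tK: "t - T *\<^sub>R x \<in> krylov A b k"
    using cheb_pair_krylov[OF Ax, of B c s k] by (simp add: t_def T_def B_def prod_eq_iff)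
  \<comment> \<open>Subtracting \<open>T *\<^sub>R x\<close> puts \<open>t\<close> into the Krylov
    space; the scaling turns \<open>y - x\<close> into a multiple of \<open>t\<close>.\<close>
  define y where "y = (- 1 / T) *\<^sub>R (t - T *\<^sub>R x)"
  have "y \<in> krylov A b k" unfolding y_def by (rule krylov_scale[OF tK])
  have yx: "y - x = (- 1 / T) *\<^sub>R t" using Tpos by (simp add: y_def algebra_simps)
  have "m * (norm (cg A b k - x))\<^sup>2 \<le> (cg A b k - x) \<bullet> (A *v (cg A b k - x))"
    using lo by (simp add: dot_square_norm)
  also have "\<dots> \<le> (y - x) \<bullet> (A *v (y - x))"
    by (rule cg_optimal[OF sym _ Ax \<open>y \<in> krylov A b k\<close>]) (rule pd)
  also have "\<dots> = q t t / T\<^sup>2"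
  proof -
    have "(a *\<^sub>R t) \<bullet> (A *v (a *\<^sub>R t)) = a\<^sup>2 * q t t" for a
      by (simp add: q_def matrix_vector_mult_scaleR power2_eq_square)
    then show ?thesis unfolding yx by (simp only:) (simp add: power_divide)
  qed
  also have "\<dots> \<le> q x x / T\<^sup>2" using \<open>q t t \<le> q x x\<close> by (simp add: divide_right_mono)
  also have "\<dots> \<le> (L * (norm x)\<^sup>2) / T\<^sup>2"
    using up[of x] by (intro divide_right_mono) (simp_all add: q_def dot_square_norm)
  also have "\<dots> = m * (\<kappa> * norm x / T)\<^sup>2" by (simp add: L power_mult_distrib power_divide)
  finally have "(norm (cg A b k - x))\<^sup>2 \<le> (\<kappa> * norm x / T)\<^sup>2" using m by simp
  then have "norm (cg A b k - x) \<le> \<kappa> * norm x / T"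
    by (rule power2_le_imp_le) (use \<kappa> Tpos in simp)
  then have "T * norm (cg A b k - x) \<le> \<kappa> * norm x" using Tpos by (simp add: field_simps)
  moreover have "z ^ k * norm (cg A b k - x) \<le> 2 * T * norm (cg A b k - x)"
    using Tz by (simp add: mult_right_mono)
  ultimately have "z ^ k * norm (cg A b k - x) \<le> 2 * \<kappa> * norm x" by linarith
  then show ?thesis unfolding z_def \<kappa>_def by simp
qed

subsection \<open>Second derivatives\<close>

lemma DERIV_along_line:
  fixes f :: "real^'n \<Rightarrow> real"
  assumes "\<And>y. (f has_derivative (\<lambda>h. g y \<bullet> h)) (at y)"
  shows "((\<lambda>s. f (a + s *\<^sub>R u)) has_real_derivative (g (a + s *\<^sub>R u) \<bullet> u)) (at s)"
proof -
  have "((\<lambda>s. a + s *\<^sub>R u) has_derivative (\<lambda>k. k *\<^sub>R u)) (at s)"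
    by (auto intro!: derivative_eq_intros)
  from has_derivative_compose[OF this assms] show ?thesis
    unfolding has_field_derivative_def
    by (rule has_derivative_eq_rhs) (simp add: fun_eq_iff)
qed

lemma DERIV_inner_along_line:
  fixes g :: "real^'n \<Rightarrow> real^'n"
  assumes "\<And>y. (g has_derivative (\<lambda>h. H y *v h)) (at y)"
  shows "((\<lambda>s. g (a + s *\<^sub>R u) \<bullet> e) has_real_derivative ((H (a + s *\<^sub>R u) *v u) \<bullet> e)) (at s)"
proof -
  have "((\<lambda>s. a + s *\<^sub>R u) has_derivative (\<lambda>k. k *\<^sub>R u)) (at s)"
    by (auto intro!: derivative_eq_intros)
  from has_derivative_inner_left[OF has_derivative_compose[OF this assms], of e] show ?thesis
    unfolding has_field_derivative_def
    by (rule has_derivative_eq_rhs) (simp add: fun_eq_iff matrix_vector_mult_scaleR)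
qed

text \<open>Two mean value theorems: first in direction \<open>u\<close> for the difference of
  \<open>f\<close> along two parallel lines, then in direction \<open>v\<close> for the resulting
  difference of gradients.\<close>

lemma second_difference_mean_value:
  fixes f :: "real^'n \<Rightarrow> real"
  assumes f: "\<And>y. (f has_derivative (\<lambda>h. g y \<bullet> h)) (at y)"
    and g: "\<And>y. (g has_derivative (\<lambda>h. H y *v h)) (at y)" and h: "h > 0"
  shows "\<exists>y. norm (y - x) \<le> h * (norm u + norm v) \<and>
    f (x + h *\<^sub>R u + h *\<^sub>R v) - f (x + h *\<^sub>R u) - f (x + h *\<^sub>R v) + f x = h\<^sup>2 * (u \<bullet> (H y *v v))"
proof -
  define \<phi> where "\<phi> = (\<lambda>s. f (x + h *\<^sub>R v + s *\<^sub>R u) - f (x + s *\<^sub>R u))"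
  have der: "(\<phi> has_real_derivative (g (x + h *\<^sub>R v + s *\<^sub>R u) \<bullet> u - g (x + s *\<^sub>R u) \<bullet> u)) (at s)" for s
    unfolding \<phi>_def by (intro DERIV_diff DERIV_along_line f)
  then obtain s where s: "0 < s" "s < h"
    "\<phi> h - \<phi> 0 = (h - 0) * (g (x + h *\<^sub>R v + s *\<^sub>R u) \<bullet> u - g (x + s *\<^sub>R u) \<bullet> u)"
    using MVT2[OF h der] by blast
  define \<psi> where "\<psi> = (\<lambda>t. g ((x + s *\<^sub>R u) + t *\<^sub>R v) \<bullet> u)"
  have der': "(\<psi> has_real_derivative ((H ((x + s *\<^sub>R u) + t *\<^sub>R v) *v v) \<bullet> u)) (at t)" for t
    unfolding \<psi>_def by (intro DERIV_inner_along_line g)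
  then obtain t where t: "0 < t" "t < h"
    "\<psi> h - \<psi> 0 = (h - 0) * ((H ((x + s *\<^sub>R u) + t *\<^sub>R v) *v v) \<bullet> u)"
    using MVT2[OF h der'] by blast
  have "norm (x + s *\<^sub>R u + t *\<^sub>R v - x) \<le> norm (s *\<^sub>R u) + norm (t *\<^sub>R v)"
    by (metis add.assoc add_diff_cancel_left' norm_triangle_ineq)
  also have "\<dots> \<le> h * norm u + h * norm v"
    using s t by (intro add_mono) (auto intro!: mult_right_mono)
  finally have "norm (x + s *\<^sub>R u + t *\<^sub>R v - x) \<le> h * (norm u + norm v)" by (simp add: distrib_left)
  moreover have "f (x + h *\<^sub>R u + h *\<^sub>R v) - f (x + h *\<^sub>R u) - f (x + h *\<^sub>R v) + f x = \<phi> h - \<phi> 0"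
    by (simp add: \<phi>_def algebra_simps)
  moreover have "\<phi> h - \<phi> 0 = h * (\<psi> h - \<psi> 0)" using s(3) by (simp add: \<psi>_def algebra_simps)
  ultimately show ?thesis
    using t(3) by (intro exI[of _ "x + s *\<^sub>R u + t *\<^sub>R v"]) (simp add: power2_eq_square inner_commute)
qed

text \<open>The second difference is unchanged when \<open>u\<close> and \<open>v\<close> are
  swapped. Equating its two mean value forms and letting the step 1/(n+1) tend to 0 gives symmetry
  by continuity of \<open>H\<close>.\<close>

lemma hessian_symmetric:
  fixes f :: "real^'n \<Rightarrow> real"
  assumes f: "\<And>y. (f has_derivative (\<lambda>h. g y \<bullet> h)) (at y)"
    and g: "\<And>y. (g has_derivative (\<lambda>h. H y *v h)) (at y)" and H: "continuous_on UNIV H"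
  shows "sym_mat (H x)"
  unfolding sym_mat_def
proof (intro allI)
  fix u v :: "real^'n"
  define C where "C = norm u + norm v"
  have "\<exists>y y'. norm (y - x) \<le> 1 / real (Suc n) * C \<and> norm (y' - x) \<le> 1 / real (Suc n) * C \<and>
      u \<bullet> (H y *v v) = v \<bullet> (H y' *v u)" for n
  proof -
    define h where "h = 1 / real (Suc n)"
    have h: "h > 0" by (simp add: h_def)
    obtain y where y: "norm (y - x) \<le> h * C"
      "f (x + h *\<^sub>R u + h *\<^sub>R v) - f (x + h *\<^sub>R u) - f (x + h *\<^sub>R v) + f x = h\<^sup>2 * (u \<bullet> (H y *v v))"
      using second_difference_mean_value[OF f g h] unfolding C_def by blast
    obtain y' where y': "norm (y' - x) \<le> h * (norm v + norm u)"
      "f (x + h *\<^sub>R v + h *\<^sub>R u) - f (x + h *\<^sub>R v) - f (x + h *\<^sub>R u) + f x = h\<^sup>2 * (v \<bullet> (H y' *v u))"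
      using second_difference_mean_value[OF f g h] by blast
    have "h\<^sup>2 * (u \<bullet> (H y *v v)) = h\<^sup>2 * (v \<bullet> (H y' *v u))"
      unfolding y(2)[symmetric] y'(2)[symmetric] by (simp add: algebra_simps)
    then show ?thesis
      using h y(1) y'(1) unfolding h_def[symmetric] C_def by (auto simp: add.commute)
  qed
  then obtain Y Y' where Y: "\<And>n. norm (Y n - x) \<le> 1 / real (Suc n) * C"
    "\<And>n. norm (Y' n - x) \<le> 1 / real (Suc n) * C" "\<And>n. u \<bullet> (H (Y n) *v v) = v \<bullet> (H (Y' n) *v u)"
    by metis
  have lim: "(\<lambda>n. 1 / real (Suc n) * C) \<longlonglongrightarrow> 0"
    using tendsto_mult[OF LIMSEQ_inverse_real_of_nat tendsto_const[of C]] by (simp add: inverse_eq_divide)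
  have "Y \<longlonglongrightarrow> x"
    by (rule LIM_zero_cancel, rule Lim_null_comparison[OF always_eventually lim]) (use Y(1) in blast)
  have "Y' \<longlonglongrightarrow> x"
    by (rule LIM_zero_cancel, rule Lim_null_comparison[OF always_eventually lim]) (use Y(2) in blast)
  have cont: "isCont (\<lambda>y. a \<bullet> (H y *v b)) x" for a b
  proof -
    have "isCont H x" using H by (simp add: continuous_on_eq_continuous_at)
    then show ?thesis unfolding matrix_vector_mult_def inner_vec_def
      by (auto intro!: continuous_intros)
  qed
  have "(\<lambda>n. u \<bullet> (H (Y n) *v v)) \<longlonglongrightarrow> u \<bullet> (H x *v v)"
    by (rule isCont_tendsto_compose[OF cont \<open>Y \<longlonglongrightarrow> x\<close>])
  moreover have "(\<lambda>n. v \<bullet> (H (Y' n) *v u)) \<longlonglongrightarrow> v \<bullet> (H x *v u)"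
    by (rule isCont_tendsto_compose[OF cont \<open>Y' \<longlonglongrightarrow> x\<close>])
  ultimately show "u \<bullet> (H x *v v) = v \<bullet> (H x *v u)"
    unfolding Y(3) by (rule LIMSEQ_unique)
qed

text \<open>Taylor's estimate without integrals: the remainder \<open>e\<close> is tested against
  itself along the segment, and a scalar function is shown to be nonincreasing.\<close>

lemma newton_remainder_bound:
  fixes G :: "real^'n \<Rightarrow> real^'n"
  assumes G: "\<And>y. (G has_derivative (\<lambda>h. H y *v h)) (at y)"
    and lip: "\<And>y z. matnorm (H y - H z) \<le> M * norm (y - z)"
  shows "norm (H w *v (w - a) - (G w - G a)) \<le> M / 2 * (norm (w - a))\<^sup>2"
proof (cases "H w *v (w - a) - (G w - G a) = 0")
  case True
  \<comment> \<open>The sign of \<open>M\<close> is not assumed; the Lipschitz condition at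
    \<open>w\<close>, \<open>a\<close> supplies what is needed.\<close>
  have "0 \<le> M * norm (w - a)"
    using lip[of w a] onorm_pos_le[OF matrix_vector_mul_bounded_linear[of "H w - H a"]]
    by (simp add: matnorm_def)
  then have "0 \<le> M * norm (w - a) * norm (w - a)" by simp
  then show ?thesis using True by (simp add: power2_eq_square)
next
  case False
  define v where "v = w - a"
  define e where "e = H w *v (w - a) - (G w - G a)"
  \<comment> \<open>The last term has derivative M |v|^2 |e| (1 - t), the Lipschitz bound at
    distance (1 - t)|v| from \<open>w\<close>. Its value at t = 1 yields the factor 1/2.\<close>
  define \<psi> where "\<psi> = (\<lambda>t. t * ((H w *v v) \<bullet> e) - G (a + t *\<^sub>R v) \<bullet> e
      - M * (norm v)\<^sup>2 * norm e * (t - t\<^sup>2 / 2))"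
  have d: "(\<psi> has_real_derivative ((H w *v v) \<bullet> e - (H (a + t *\<^sub>R v) *v v) \<bullet> e
      - M * (norm v)\<^sup>2 * norm e * (1 - t))) (at t)" for t
    unfolding \<psi>_def
    by (rule derivative_eq_intros DERIV_inner_along_line[OF G] refl | simp)+
  have neg: "(H w *v v) \<bullet> e - (H (a + t *\<^sub>R v) *v v) \<bullet> e - M * (norm v)\<^sup>2 * norm e * (1 - t) \<le> 0"
    if t: "0 \<le> t" "t \<le> 1" for t
  proof -
    have wv: "w - (a + t *\<^sub>R v) = (1 - t) *\<^sub>R v" by (simp add: v_def algebra_simps)
    have "(H w *v v) \<bullet> e - (H (a + t *\<^sub>R v) *v v) \<bullet> e = ((H w - H (a + t *\<^sub>R v)) *v v) \<bullet> e"
      by (simp add: matrix_vector_mult_diff_rdistrib inner_diff_left)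
    also have "\<dots> \<le> norm ((H w - H (a + t *\<^sub>R v)) *v v) * norm e" by (rule norm_cauchy_schwarz)
    also have "\<dots> \<le> (matnorm (H w - H (a + t *\<^sub>R v)) * norm v) * norm e"
      by (intro mult_right_mono norm_le_matnorm) simp
    also have "\<dots> \<le> (M * norm (w - (a + t *\<^sub>R v)) * norm v) * norm e"
      by (intro mult_right_mono lip) simp_all
    also have "\<dots> = M * (norm v)\<^sup>2 * norm e * (1 - t)"
      unfolding wv using t by (simp add: power2_eq_square)
    finally show ?thesis by simp
  qed
  have "\<psi> 1 \<le> \<psi> 0"
    by (rule DERIV_nonpos_imp_nonincreasing) (use d neg in \<open>auto intro!: exI\<close>)
  moreover have "\<psi> 1 - \<psi> 0 = norm e * norm e - M / 2 * (norm v)\<^sup>2 * norm e"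
  proof -
    have "\<psi> 1 - \<psi> 0 = e \<bullet> e - M / 2 * (norm v)\<^sup>2 * norm e"
      by (simp add: \<psi>_def v_def e_def inner_diff_left)
    then show ?thesis by (simp add: dot_square_norm power2_eq_square)
  qed
  ultimately have "norm e * norm e \<le> norm e * (M / 2 * (norm v)\<^sup>2)" by (simp add: algebra_simps)
  moreover have "norm e > 0" using False by (simp add: e_def)
  ultimately show ?thesis by (simp add: e_def v_def)
qed

text \<open>Testing against the increment \<open>e\<close> reduces the vector-valued claim to the
  scalar mean value theorem.\<close>

lemma gradient_Lipschitz:
  fixes G :: "real^'n \<Rightarrow> real^'n"
  assumes G: "\<And>y. (G has_derivative (\<lambda>h. H y *v h)) (at y)"
    and bd: "\<And>y x. norm (H y *v x) \<le> L * norm x"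
  shows "norm (G w - G a) \<le> L * norm (w - a)"
proof -
  define e where "e = G w - G a"
  have der: "((\<lambda>s. G (a + s *\<^sub>R (w - a)) \<bullet> e) has_real_derivative ((H (a + s *\<^sub>R (w - a)) *v (w - a)) \<bullet> e)) (at s)" for s
    by (rule DERIV_inner_along_line[OF G])
  then obtain s where "G (a + 1 *\<^sub>R (w - a)) \<bullet> e - G (a + 0 *\<^sub>R (w - a)) \<bullet> e
      = (1 - 0) * ((H (a + s *\<^sub>R (w - a)) *v (w - a)) \<bullet> e)"
    using MVT2[OF zero_less_one der] by blast
  then have "e \<bullet> e = (H (a + s *\<^sub>R (w - a)) *v (w - a)) \<bullet> e" by (simp add: e_def inner_diff_left)
  also have "\<dots> \<le> norm (H (a + s *\<^sub>R (w - a)) *v (w - a)) * norm e" by (rule norm_cauchy_schwarz)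
  also have "\<dots> \<le> L * norm (w - a) * norm e" by (intro mult_right_mono bd) simp
  finally have *: "norm e * norm e \<le> norm e * (L * norm (w - a))"
    by (simp add: dot_square_norm power2_eq_square algebra_simps)
  have "0 \<le> L * norm (w - a)" using bd[of w "w - a"] norm_ge_zero order_trans by blast
  then show ?thesis using * by (cases "norm e = 0") (simp_all add: e_def)
qed

subsection \<open>Sampling\<close>

text \<open>The alphabet is arbitrary, so that one sample (draws of indices) and a whole history
  (draws of samples) are both instances.\<close>

definition draws :: "'a set \<Rightarrow> nat \<Rightarrow> 'a list set" where
  "draws A n = {xs. set xs \<subseteq> A \<and> length xs = n}"

lemma finite_draws: "finite A \<Longrightarrow> finite (draws A n)"
  unfolding draws_def by (rule finite_lists_length_eq)

lemma card_draws: "finite A \<Longrightarrow> card (draws A n) = card A ^ n"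
  unfolding draws_def by (rule card_lists_length_eq)

text \<open>The new draw is appended at the end, matching \<open>foldl\<close> in
  \<open>SN_iter\<close>, where the newest sample acts last.\<close>

lemma draws_Suc: "draws A (Suc n) = (\<lambda>(xs, x). xs @ [x]) ` (draws A n \<times> A)"
proof (intro set_eqI iffI)
  fix ys assume "ys \<in> draws A (Suc n)"
  then have "ys \<noteq> []" "set ys \<subseteq> A" "length ys = Suc n" by (auto simp: draws_def)
  then have "ys = butlast ys @ [last ys]" "butlast ys \<in> draws A n" "last ys \<in> A"
    by (auto simp: draws_def dest: in_set_butlastD)
  then show "ys \<in> (\<lambda>(xs, x). xs @ [x]) ` (draws A n \<times> A)"
    by (intro image_eqI[of _ _ "(butlast ys, last ys)"]) auto
qed (auto simp: draws_def)

lemma sum_draws_Suc: "sum f (draws A (Suc n)) = (\<Sum>xs\<in>draws A n. \<Sum>x\<in>A. f (xs @ [x]))"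
  unfolding draws_Suc
  by (subst sum.reindex) (auto simp: inj_on_def sum.cartesian_product intro!: sum.cong)

text \<open>Additivity of variance for independent centred draws, as a counting identity. Summing
  over the last draw kills the cross term; the factor \<open>card A\<close> on the left avoids a
  division.\<close>

lemma sum_norm_sq_draws:
  fixes X :: "'a \<Rightarrow> 'b::real_inner"
  assumes A: "finite A" and mean: "(\<Sum>i\<in>A. X i) = 0"
  shows "real (card A) * (\<Sum>S\<in>draws A n. (norm (\<Sum>i\<leftarrow>S. X i))\<^sup>2)
    = real n * real (card A) ^ n * (\<Sum>i\<in>A. (norm (X i))\<^sup>2)"
proof (induction n)
  case 0
  then show ?case by (simp add: draws_def)
next
  case (Suc n)
  define Y where "Y = (\<lambda>S. \<Sum>i\<leftarrow>S. X i)"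
  define Q where "Q = (\<Sum>i\<in>A. (norm (X i))\<^sup>2)"
  have inner: "(\<Sum>x\<in>A. (norm (y + X x))\<^sup>2) = real (card A) * (norm y)\<^sup>2 + Q" for y
  proof -
    have "(\<Sum>x\<in>A. (norm (y + X x))\<^sup>2) = (\<Sum>x\<in>A. (norm y)\<^sup>2 + 2 * (y \<bullet> X x) + (norm (X x))\<^sup>2)"
      by (simp add: power2_norm_eq_inner inner_add_left inner_add_right inner_commute add_ac)
    also have "\<dots> = real (card A) * (norm y)\<^sup>2 + 2 * (y \<bullet> (\<Sum>x\<in>A. X x)) + Q"
      by (simp add: sum.distrib Q_def inner_sum_right sum_distrib_left)
    finally show ?thesis by (simp add: mean)
  qed
  have "(\<Sum>S\<in>draws A (Suc n). (norm (Y S))\<^sup>2)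
      = (\<Sum>S\<in>draws A n. real (card A) * (norm (Y S))\<^sup>2 + Q)"
    by (simp add: sum_draws_Suc Y_def inner)
  also have "\<dots> = real (card A) * (\<Sum>S\<in>draws A n. (norm (Y S))\<^sup>2) + real (card A) ^ n * Q"
    by (simp add: sum.distrib sum_distrib_left card_draws A)
  also have "\<dots> = real (Suc n) * real (card A) ^ n * Q"
    using Suc.IH by (simp add: Y_def Q_def algebra_simps)
  finally show ?case by (simp add: Y_def Q_def)
qed

text \<open>Cauchy-Schwarz over all draws passes from the second moment to the first.\<close>

lemma sum_norm_draws_le:
  fixes X :: "'a \<Rightarrow> 'b::real_inner"
  assumes A: "finite A" "A \<noteq> {}" and mean: "(\<Sum>i\<in>A. X i) = 0"
    and var: "(\<Sum>i\<in>A. (norm (X i))\<^sup>2) \<le> real (card A) * s\<^sup>2" and "s \<ge> 0"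
  shows "(\<Sum>S\<in>draws A n. norm (\<Sum>i\<leftarrow>S. X i)) \<le> real (card A) ^ n * (sqrt (real n) * s)"
proof -
  have c: "real (card A) > 0" using A by (simp add: card_gt_0_iff)
  have "real (card A) * (\<Sum>S\<in>draws A n. (norm (\<Sum>i\<leftarrow>S. X i))\<^sup>2)
      \<le> real n * real (card A) ^ n * (real (card A) * s\<^sup>2)"
    unfolding sum_norm_sq_draws[OF A(1) mean] by (intro mult_left_mono var) simp
  then have "real (card A) * (\<Sum>S\<in>draws A n. (norm (\<Sum>i\<leftarrow>S. X i))\<^sup>2)
      \<le> real (card A) * (real n * real (card A) ^ n * s\<^sup>2)" by (simp add: algebra_simps)
  then have sq: "(\<Sum>S\<in>draws A n. (norm (\<Sum>i\<leftarrow>S. X i))\<^sup>2) \<le> real n * real (card A) ^ n * s\<^sup>2"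
    using c by (simp only: mult_le_cancel_left_pos)
  have "(\<Sum>S\<in>draws A n. norm (\<Sum>i\<leftarrow>S. X i))\<^sup>2
      \<le> (\<Sum>S\<in>draws A n. (norm (\<Sum>i\<leftarrow>S. X i))\<^sup>2) * real (card (draws A n))"
    by (rule sum_squared_le_sum_of_squares)
  also have "\<dots> \<le> (real n * real (card A) ^ n * s\<^sup>2) * real (card (draws A n))"
    by (intro mult_right_mono sq) simp
  also have "\<dots> = (real (card A) ^ n * (sqrt (real n) * s))\<^sup>2"
    by (simp add: card_draws A power_mult_distrib power2_eq_square)
  finally show ?thesis
    by (rule power2_le_imp_le) (use \<open>s \<ge> 0\<close> in simp)
qed

section \<open>Expectations over sample histories\<close>

lemma samples_eq_draws: "samples N b k = draws (draws {..<N} b) k"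
  by (auto simp: samples_def draws_def)

lemma sample_expect_eq:
  assumes "N \<ge> 1"
  shows "sample_expect N b k f = sum f (samples N b k) / real (N ^ b) ^ k"
proof -
  have fin: "finite (samples N b k)"
    by (simp add: samples_eq_draws finite_draws)
  have card: "card (samples N b k) = (N ^ b) ^ k"
    by (simp add: samples_eq_draws card_draws finite_draws)
  then have "samples N b k \<noteq> {}" using assms by auto
  then show ?thesis
    unfolding sample_expect_def using fin by (simp add: integral_pmf_of_set card)
qed

text \<open>The tower property: for each fixed past, the average over the fresh sample is bounded
  first, then the past is averaged.\<close>

lemma sample_expect_Suc_le:
  assumes "N \<ge> 1"
    and "\<And>ss. ss \<in> samples N b k \<Longrightarrow> (\<Sum>S\<in>draws {..<N} b. f (ss @ [S])) \<le> real (N ^ b) * g ss"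
  shows "sample_expect N b (Suc k) f \<le> sample_expect N b k g"
proof -
  define c where "c = real (N ^ b)"
  have c: "c > 0" using assms(1) by (simp add: c_def)
  have "sum f (samples N b (Suc k)) = (\<Sum>ss\<in>samples N b k. \<Sum>S\<in>draws {..<N} b. f (ss @ [S]))"
    unfolding samples_eq_draws by (rule sum_draws_Suc)
  also have "\<dots> \<le> (\<Sum>ss\<in>samples N b k. c * g ss)"
    unfolding c_def by (intro sum_mono assms(2))
  finally have "sum f (samples N b (Suc k)) \<le> c * sum g (samples N b k)"
    by (simp add: sum_distrib_left)
  then have "sum f (samples N b (Suc k)) / c ^ Suc k \<le> c * sum g (samples N b k) / c ^ Suc k"
    using c by (intro divide_right_mono) simp_all
  also have "\<dots> = sum g (samples N b k) / c ^ k" using c by simp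
  finally show ?thesis
    unfolding sample_expect_eq[OF assms(1)] c_def .
qed

subsection \<open>One inexact Newton step\<close>

text \<open>The bound on \<open>r\<close> says that the r-th power of the rate is at least 16 (L/m)
  sqrt(K/m). The rate estimate then gives an error of at most m |x| / (8L), while m |x| <= |b| <= L
  \<open>nv\<close>.\<close>

lemma cg_error_bound:
  fixes A :: "real^'n^'n"
  assumes sym: "sym_mat A" and A: "loewner_between m A K" and m: "0 < m" "1 < K / m" and L: "0 < L"
    and r: "real r \<ge> ln (16 * L / m * sqrt (K / m)) / ln ((sqrt (K / m) + 1) / (sqrt (K / m) - 1))"
    and x: "A *v x = b" and b: "norm b \<le> L * nv"
  shows "norm (cg A b r - x) \<le> nv / 8"
proof -
  define \<kappa> where "\<kappa> = sqrt (K / m)"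
  define z where "z = (\<kappa> + 1) / (\<kappa> - 1)"
  have \<kappa>: "\<kappa> > 1" using m by (simp add: \<kappa>_def)
  then have z: "z > 1" by (simp add: z_def)
  have mK: "m < K" using m by (simp add: field_simps)
  have lo: "m * (v \<bullet> v) \<le> v \<bullet> (A *v v)" and up: "v \<bullet> (A *v v) \<le> K * (v \<bullet> v)" for v
    using A by (auto simp: loewner_between_def)
  have pos: "16 * L / m * \<kappa> > 0" using L m \<kappa> by simp
  have "ln (16 * L / m * \<kappa>) \<le> real r * ln z"
    using r z unfolding \<kappa>_def[symmetric] z_def[symmetric] by (simp add: pos_divide_le_eq)
  also have "\<dots> = ln (z ^ r)" using z by (simp add: ln_realpow)
  finally have zr: "16 * L / m * \<kappa> \<le> z ^ r" using pos z by (subst (asm) ln_le_cancel_iff) simp_all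
  have "16 * L / m * \<kappa> * norm (cg A b r - x) \<le> z ^ r * norm (cg A b r - x)"
    by (intro mult_right_mono zr) simp
  also have "\<dots> \<le> 2 * \<kappa> * norm x"
    unfolding z_def \<kappa>_def by (rule cg_convergence[OF sym m(1) mK lo up x])
  finally have "\<kappa> * (16 * L / m * norm (cg A b r - x)) \<le> \<kappa> * (2 * norm x)" by (simp add: algebra_simps)
  then have "16 * L / m * norm (cg A b r - x) \<le> 2 * norm x"
    by (rule mult_left_le_imp_le) (use \<kappa> in simp)
  then have "16 * L * norm (cg A b r - x) \<le> 2 * (m * norm x)" using m by (simp add: field_simps)
  moreover have "m * norm x \<le> L * nv" using coercive_norm_image_ge[of m A x, OF lo] x b by simp
  ultimately have "L * (16 * norm (cg A b r - x)) \<le> L * (2 * nv)" by linarith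
  then show ?thesis using L by simp
qed

lemma inexact_newton_step_error:
  fixes A H :: "real^'n^'n"
  assumes sym: "sym_mat A" and A: "loewner_between m A K" and m: "0 < m" "1 < K / m" and L: "0 < L"
    and r: "real r \<ge> ln (16 * L / m * sqrt (K / m)) / ln ((sqrt (K / m) + 1) / (sqrt (K / m) - 1))"
    and g: "norm g \<le> L * norm (w - a)"
    and rem: "norm (H *v (w - a) - g) \<le> M / 2 * (norm (w - a))\<^sup>2"
  shows "norm (w + cg A (- g) r - a)
    \<le> norm (A *v (w - a) - H *v (w - a)) / m + M / (2 * m) * (norm (w - a))\<^sup>2 + norm (w - a) / 8"
proof -
  have lo: "m * (v \<bullet> v) \<le> v \<bullet> (A *v v)" for v using A by (auto simp: loewner_between_def)
  \<comment> \<open>Coercivity gives injectivity, hence surjectivity in finite dimension;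
    \<open>x\<close> is the exact subsampled Newton step.\<close>
  have "inj ((*v) A)"
  proof (subst linear_injective_0)
    show "\<forall>x. A *v x = 0 \<longrightarrow> x = 0"
      using coercive_norm_image_ge[of m A, OF lo] m by (metis mult_le_0_iff norm_eq_zero norm_le_zero_iff not_le)
  qed (rule matrix_vector_mul_linear)
  then have "surj ((*v) A)" by (intro linear_inj_imp_surj matrix_vector_mul_linear)
  then obtain x where x: "A *v x = - g" by (metis surjD)
  have cg: "norm (cg A (- g) r - x) \<le> norm (w - a) / 8"
    by (rule cg_error_bound[OF sym A m L r x]) (use g in simp)
  have "m * norm (w - a + x) \<le> norm (A *v (w - a + x))" by (rule coercive_norm_image_ge[OF lo])
  \<comment> \<open>Applying \<open>A\<close> to the error of the exact step separates sampling
    error from Taylor remainder without forming an inverse; coercivity then divides by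
    \<open>m\<close>.\<close>
  also have "A *v (w - a + x) = (A *v (w - a) - H *v (w - a)) + (H *v (w - a) - g)"
    by (simp add: matrix_vector_right_distrib x)
  also have "norm \<dots> \<le> norm (A *v (w - a) - H *v (w - a)) + M / 2 * (norm (w - a))\<^sup>2"
    using norm_triangle_ineq rem by (meson add_left_mono order_trans)
  finally have "norm (w - a + x)
      \<le> (norm (A *v (w - a) - H *v (w - a)) + M / 2 * (norm (w - a))\<^sup>2) / m"
    using m by (simp add: pos_le_divide_eq mult.commute)
  also have "\<dots> = norm (A *v (w - a) - H *v (w - a)) / m + M / (2 * m) * (norm (w - a))\<^sup>2"
    by (simp add: add_divide_distrib)
  finally have "norm (w - a + x) \<le> \<dots>" .
  moreover have "w + cg A (- g) r - a = (w - a + x) + (cg A (- g) r - x)" by simp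
  then have "norm (w + cg A (- g) r - a) \<le> norm (w - a + x) + norm (cg A (- g) r - x)"
    by (metis norm_triangle_ineq)
  ultimately show ?thesis using cg by linarith
qed

text \<open>Only the action on the fixed vector \<open>v\<close> is measured, so the variance of
  vectors suffices. Symmetry turns |D_i v|^2 into <v, D_i^2 v>, whose average the variance
  hypothesis bounds.\<close>

lemma subsampled_hessian_deviation:
  fixes hessF :: "nat \<Rightarrow> real^'n \<Rightarrow> real^'n^'n" and \<sigma> :: real
  assumes N: "N \<ge> 1" and b: "b \<ge> 1" and sym: "\<And>i. i < N \<Longrightarrow> sym_mat (hessF i w)"
    and var: "matnorm ((1 / real N) *\<^sub>R
      (\<Sum>i<N. (hessF i w - hess_avg hessF N w) ** (hessF i w - hess_avg hessF N w))) \<le> \<sigma>\<^sup>2"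
  shows "(\<Sum>S\<in>draws {..<N} b. norm (hess_sub hessF S w *v v - hess_avg hessF N w *v v))
    \<le> real (N ^ b) * (\<bar>\<sigma>\<bar> / sqrt (real b) * norm v)"
proof -
  let ?H = "hess_avg hessF N w"
  define D where "D = (\<lambda>i. hessF i w - ?H)"
  define X where "X = (\<lambda>i. D i *v v)"
  have symH: "sym_mat ?H"
    unfolding hess_avg_def by (intro sym_mat_scaleR sym_mat_sum sym) simp
  have symD: "sym_mat (D i)" if "i < N" for i
    unfolding D_def by (intro sym_mat_diff sym symH that)
  have "(\<Sum>i<N. D i) = (\<Sum>i<N. hessF i w) - real N *\<^sub>R ?H"
    by (simp add: D_def sum_subtractf sum_constant_scaleR del: sum_constant)
  also have "\<dots> = 0" using N by (simp add: hess_avg_def)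
  finally have mean: "(\<Sum>i<N. X i) = 0"
    unfolding X_def by (simp flip: sum_matrix_vector_mult)
  have "(\<Sum>i<N. (norm (X i))\<^sup>2) = v \<bullet> ((\<Sum>i<N. D i ** D i) *v v)"
  proof -
    have "(norm (X i))\<^sup>2 = v \<bullet> ((D i ** D i) *v v)" if "i < N" for i
      using sym_matD[OF symD[OF that], of v "D i *v v"]
      by (simp add: X_def power2_norm_eq_inner matrix_vector_mul_assoc[symmetric])
    then show ?thesis by (simp add: sum_matrix_vector_mult inner_sum_right)
  qed
  also have "\<dots> = real N * (v \<bullet> (((1 / real N) *\<^sub>R (\<Sum>i<N. D i ** D i)) *v v))"
    using N by (simp add: scaleR_matrix_vector_assoc[symmetric])
  also have "\<dots> \<le> real N * (\<sigma>\<^sup>2 * (norm v)\<^sup>2)"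
  proof (rule mult_left_mono)
    have "v \<bullet> (((1 / real N) *\<^sub>R (\<Sum>i<N. D i ** D i)) *v v)
        \<le> norm v * norm (((1 / real N) *\<^sub>R (\<Sum>i<N. D i ** D i)) *v v)"
      by (rule norm_cauchy_schwarz)
    also have "\<dots> \<le> norm v * (matnorm ((1 / real N) *\<^sub>R (\<Sum>i<N. D i ** D i)) * norm v)"
      by (intro mult_left_mono norm_le_matnorm) simp
    also have "\<dots> \<le> norm v * (\<sigma>\<^sup>2 * norm v)"
      using var by (intro mult_left_mono mult_right_mono) (simp_all add: D_def)
    finally show "v \<bullet> (((1 / real N) *\<^sub>R (\<Sum>i<N. D i ** D i)) *v v) \<le> \<sigma>\<^sup>2 * (norm v)\<^sup>2"
      by (simp add: power2_eq_square algebra_simps)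
  qed simp
  finally have "(\<Sum>i<N. (norm (X i))\<^sup>2) \<le> real (card {..<N}) * (\<bar>\<sigma>\<bar> * norm v)\<^sup>2"
    by (simp add: power_mult_distrib)
  then have main: "(\<Sum>S\<in>draws {..<N} b. norm (\<Sum>i\<leftarrow>S. X i))
      \<le> real (N ^ b) * (sqrt (real b) * (\<bar>\<sigma>\<bar> * norm v))"
    using sum_norm_draws_le[of "{..<N}" X "\<bar>\<sigma>\<bar> * norm v" b] N mean
    by (auto simp: lessThan_empty_iff)
  have dev: "hess_sub hessF S w *v v - ?H *v v = (1 / real b) *\<^sub>R (\<Sum>i\<leftarrow>S. X i)"
    if "S \<in> draws {..<N} b" for S
  proof -
    have len: "length S = b" using that by (simp add: draws_def)
    have "(\<Sum>i\<leftarrow>S. X i) = (\<Sum>i\<leftarrow>S. hessF i w *v v) - real (length S) *\<^sub>R (?H *v v)"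
      by (induction S) (auto simp: X_def D_def matrix_vector_mult_diff_rdistrib algebra_simps)
    then show ?thesis
      using b by (simp add: hess_sub_def len scaleR_matrix_vector_assoc[symmetric]
          sum_list_matrix_vector_mult scaleR_right_diff_distrib)
  qed
  have "(\<Sum>S\<in>draws {..<N} b. norm (hess_sub hessF S w *v v - ?H *v v))
      = (1 / real b) * (\<Sum>S\<in>draws {..<N} b. norm (\<Sum>i\<leftarrow>S. X i))"
    by (simp add: dev sum_divide_distrib)
  also have "\<dots> \<le> (1 / real b) * (real (N ^ b) * (sqrt (real b) * (\<bar>\<sigma>\<bar> * norm v)))"
    by (intro mult_left_mono main) simp
  \<comment> \<open>Averaging divides by b while the random sum grows like sqrt b.\<close>
  also have "\<dots> = real (N ^ b) * (\<bar>\<sigma>\<bar> / sqrt (real b) * norm v)"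
    using b by (simp add: field_simps)
  finally show ?thesis .
qed

theorem theorem3p2:
  fixes F :: "nat \<Rightarrow> real^'n \<Rightarrow> real"
    and gradF :: "nat \<Rightarrow> real^'n \<Rightarrow> real^'n"
    and hessF :: "nat \<Rightarrow> real^'n \<Rightarrow> real^'n^'n"
    and N beta r :: nat
    and mu_b L_b :: "nat \<Rightarrow> real"
    and mubar Lbar mu L M sigma gamma :: real
    and ws w0 :: "real^'n"
  assumes N_pos: "N \<ge> 1"
    and diff1: "\<forall>i<N. \<forall>x. (F i has_derivative (\<lambda>h. gradF i x \<bullet> h)) (at x)"
    and diff2: "\<forall>i<N. \<forall>x. (gradF i has_derivative (\<lambda>h. hessF i x *v h)) (at x)"
    and cont2: "\<forall>i<N. continuous_on UNIV (hessF i)"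
    and wmin: "\<forall>w. w \<noteq> ws \<longrightarrow> R_avg F N ws < R_avg F N w"
    and A1_sub: "\<forall>b\<ge>1. 0 < mu_b b \<and> mu_b b \<le> L_b b \<and>
        (\<forall>S w. length S = b \<and> set S \<subseteq> {..<N} \<longrightarrow>
               loewner_between (mu_b b) (hess_sub hessF S w) (L_b b))"
    and A1_unif: "0 < mubar" "\<forall>b\<ge>1. mubar \<le> mu_b b \<and> L_b b \<le> Lbar"
    and A1_full: "0 < mu" "mu \<le> L" "\<forall>w. loewner_between mu (hess_avg hessF N w) L"
    and A3: "\<forall>w z. matnorm (hess_avg hessF N w - hess_avg hessF N z) \<le> M * norm (w - z)"
    and A4: "\<forall>w. matnorm ((1 / real N) *\<^sub>R
               (\<Sum>i<N. (hessF i w - hess_avg hessF N w) ** (hessF i w - hess_avg hessF N w)))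
             \<le> sigma\<^sup>2"
    and B1: "gamma > 0"
      "\<forall>k. sample_expect N beta k (\<lambda>ss. (norm (SN_iter gradF hessF N r w0 ss - ws))\<^sup>2)
           \<le> gamma * (sample_expect N beta k (\<lambda>ss. norm (SN_iter gradF hessF N r w0 ss - ws)))\<^sup>2"
    and beta: "beta \<ge> 1" "real beta \<ge> 64 * sigma\<^sup>2 / mubar\<^sup>2"
    and delta: "L_b beta / mu_b beta > 1"
    and r_bound: "real r \<ge> ln (16 * L / mu_b beta * sqrt (L_b beta / mu_b beta))
                    / ln ((sqrt (L_b beta / mu_b beta) + 1) / (sqrt (L_b beta / mu_b beta) - 1))"
    and init: "4 * (M / (2 * mu_b beta)) * norm (w0 - ws) \<le> 1"
              "4 * gamma * (M / (2 * mu_b beta)) * norm (w0 - ws) \<le> 1"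
  shows "\<forall>k. sample_expect N beta (Suc k) (\<lambda>ss. norm (SN_iter gradF hessF N r w0 ss - ws))
           \<le> 1 / 2 * sample_expect N beta k (\<lambda>ss. norm (SN_iter gradF hessF N r w0 ss - ws))"
proof -
  define \<mu> where "\<mu> = mu_b beta"
  define K where "K = L_b beta"
  define C where "C = M / (2 * \<mu>)"
  define err where "err = (\<lambda>ss. norm (SN_iter gradF hessF N r w0 ss - ws))"
  define E where "E = (\<lambda>k. sample_expect N beta k err)"
  let ?G = "grad_avg gradF N" and ?H = "hess_avg hessF N"
  have \<mu>: "\<mu> > 0" and \<mu>bar: "mubar \<le> \<mu>" using A1_sub A1_unif beta(1) by (auto simp: \<mu>_def)
  have L: "L > 0" using A1_full by linarith
  have sym: "sym_mat (hessF i w)" if "i < N" for i w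
    by (rule hessian_symmetric[where f = "F i" and g = "gradF i"]) (use diff1 diff2 cont2 that in auto)
  have symH: "sym_mat (?H w)" for w
    unfolding hess_avg_def by (intro sym_mat_scaleR sym_mat_sum sym) simp
  have derG: "(?G has_derivative (\<lambda>h. ?H w *v h)) (at w)" for w
  proof -
    have "((\<lambda>w. (1 / real N) *\<^sub>R (\<Sum>i<N. gradF i w)) has_derivative
        (\<lambda>h. (1 / real N) *\<^sub>R (\<Sum>i<N. hessF i w *v h))) (at w)"
      by (intro has_derivative_scaleR_right has_derivative_sum) (use diff2 in auto)
    then show ?thesis
      by (simp add: grad_avg_def[abs_def] hess_avg_def scaleR_matrix_vector_assoc[symmetric]
          sum_matrix_vector_mult)
  qed
  have Gws: "?G ws = 0"
  proof -
    have "((\<lambda>w. (1 / real N) *\<^sub>R (\<Sum>i<N. F i w)) has_derivative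
        (\<lambda>h. (1 / real N) *\<^sub>R (\<Sum>i<N. gradF i ws \<bullet> h))) (at ws)"
      by (intro has_derivative_scaleR_right has_derivative_sum) (use diff1 in auto)
    then have "(R_avg F N has_derivative (\<lambda>h. ?G ws \<bullet> h)) (at ws)"
      by (simp add: R_avg_def[abs_def] grad_avg_def inner_sum_left)
    moreover have "R_avg F N ws \<le> R_avg F N w" for w using wmin by (cases "w = ws") (auto intro: less_imp_le)
    ultimately have "(\<lambda>h. ?G ws \<bullet> h) = (\<lambda>h. 0)"
      by (intro has_derivative_local_min[of "R_avg F N" _ ws]) (auto intro: always_eventually)
    then have "?G ws \<bullet> ?G ws = 0" by metis
    then show ?thesis by simp
  qed
  have lo: "mu * (v \<bullet> v) \<le> v \<bullet> (?H w *v v)" and up: "v \<bullet> (?H w *v v) \<le> L * (v \<bullet> v)" for v w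
    using A1_full(3) by (auto simp: loewner_between_def)
  have psd: "0 \<le> v \<bullet> (?H w *v v)" for v w
    using lo[of v w] A1_full(1) by (meson inner_ge_zero mult_nonneg_nonneg order_trans less_imp_le)
  have Hnorm: "norm (?H w *v v) \<le> L * norm v" for w v
    by (rule sym_bounded_norm_image_le[OF symH psd up]) (use L in simp)
  have Gnorm: "norm (?G w) \<le> L * norm (w - ws)" for w
    using gradient_Lipschitz[OF derG Hnorm, of w ws] by (simp add: Gws)
  have rem: "norm (?H w *v (w - ws) - ?G w) \<le> M / 2 * (norm (w - ws))\<^sup>2" for w
    using newton_remainder_bound[OF derG, of M w ws] A3 by (simp add: Gws)
  have step: "norm (SN_step gradF hessF N r S w - ws) \<le>
      norm (hess_sub hessF S w *v (w - ws) - ?H w *v (w - ws)) / \<mu>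
      + C * (norm (w - ws))\<^sup>2 + norm (w - ws) / 8"
    if S: "S \<in> draws {..<N} beta" for S w
    unfolding SN_step_def C_def
  proof (rule inexact_newton_step_error[where K = K and L = L])
    have S': "length S = beta" "set S \<subseteq> {..<N}" using S by (auto simp: draws_def)
    show "sym_mat (hess_sub hessF S w)"
      unfolding hess_sub_def by (intro sym_mat_scaleR sym_mat_sum_list sym) (use S' in auto)
    show "loewner_between \<mu> (hess_sub hessF S w) K"
      using A1_sub beta(1) S' by (simp add: \<mu>_def K_def)
  qed (use \<mu> delta L r_bound Gnorm rem in \<open>auto simp: \<mu>_def K_def\<close>)
  \<comment> \<open>The constant 64 is 8^2: after division by \<open>\<mu>\<close> the sampling
    error contributes at most |v|/8.\<close>
  have \<sigma>: "\<bar>sigma\<bar> / sqrt (real beta) \<le> \<mu> / 8"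
  proof -
    have "64 * sigma\<^sup>2 \<le> real beta * mubar\<^sup>2"
      using beta(2) A1_unif(1) by (simp add: divide_le_eq)
    then have "(8 * \<bar>sigma\<bar>)\<^sup>2 \<le> (sqrt (real beta) * mubar)\<^sup>2" by (simp add: power_mult_distrib)
    then have "8 * \<bar>sigma\<bar> \<le> sqrt (real beta) * mubar"
      by (rule power2_le_imp_le) (use A1_unif(1) in simp)
    also have "\<dots> \<le> sqrt (real beta) * \<mu>" using \<mu>bar by (intro mult_left_mono) simp_all
    finally show ?thesis using beta(1) by (simp add: field_simps)
  qed
  \<comment> \<open>For a fixed iterate, the eighths from sampling and from conjugate gradients add
    up to 1/4.\<close>
  have sum_step: "(\<Sum>S\<in>draws {..<N} beta. norm (SN_step gradF hessF N r S w - ws))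
      \<le> real (N ^ beta) * (C * (norm (w - ws))\<^sup>2 + norm (w - ws) / 4)" for w
  proof -
    let ?v = "w - ws" and ?D = "draws {..<N} beta"
    have "(\<Sum>S\<in>?D. norm (SN_step gradF hessF N r S w - ws))
        \<le> (\<Sum>S\<in>?D. norm (hess_sub hessF S w *v ?v - ?H w *v ?v) / \<mu>
            + (C * (norm ?v)\<^sup>2 + norm ?v / 8))"
      using step by (intro sum_mono) (simp add: add.assoc)
    also have "\<dots> = (\<Sum>S\<in>?D. norm (hess_sub hessF S w *v ?v - ?H w *v ?v)) / \<mu>
        + real (N ^ beta) * (C * (norm ?v)\<^sup>2 + norm ?v / 8)"
      by (simp add: sum.distrib sum_divide_distrib card_draws)
    also have "(\<Sum>S\<in>?D. norm (hess_sub hessF S w *v ?v - ?H w *v ?v)) / \<mu>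
        \<le> (real (N ^ beta) * (\<mu> / 8 * norm ?v)) / \<mu>"
    proof (rule divide_right_mono)
      have "(\<Sum>S\<in>?D. norm (hess_sub hessF S w *v ?v - ?H w *v ?v))
          \<le> real (N ^ beta) * (\<bar>sigma\<bar> / sqrt (real beta) * norm ?v)"
        by (rule subsampled_hessian_deviation[OF N_pos beta(1) sym]) (use A4 in auto)
      also have "\<dots> \<le> real (N ^ beta) * (\<mu> / 8 * norm ?v)"
        by (intro mult_left_mono mult_right_mono \<sigma>) simp_all
      finally show "(\<Sum>S\<in>?D. norm (hess_sub hessF S w *v ?v - ?H w *v ?v))
          \<le> real (N ^ beta) * (\<mu> / 8 * norm ?v)" .
    qed (use \<mu> in simp)
    also have "(real (N ^ beta) * (\<mu> / 8 * norm ?v)) / \<mu> = real (N ^ beta) * (norm ?v / 8)"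
      using \<mu> by simp
    finally show ?thesis by (simp add: distrib_left)
  qed
  have C: "C \<ge> 0"
  proof -
    \<comment> \<open>The Lipschitz condition between two distinct points forces \<open>M\<close> to
      be nonnegative.\<close>
    obtain z :: "real^'n" where "z \<noteq> 0" using nonzero_Basis nonempty_Basis by blast
    have "0 \<le> M * norm (z - 0)"
      using A3 onorm_pos_le[OF matrix_vector_mul_bounded_linear[of "?H z - ?H 0"]]
      unfolding matnorm_def by (meson order_trans)
    then have "M \<ge> 0" using \<open>z \<noteq> 0\<close> by (simp add: zero_le_mult_iff)
    then show ?thesis using \<mu> by (simp add: C_def)
  qed
  have E_nonneg: "E k \<ge> 0" for k
    by (simp add: E_def err_def sample_expect_eq[OF N_pos] sum_nonneg)
  have rec: "E (Suc k) \<le> C * gamma * (E k)\<^sup>2 + E k / 4" for k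
  proof -
    have "E (Suc k) \<le> sample_expect N beta k (\<lambda>ss. C * (err ss)\<^sup>2 + err ss / 4)"
      unfolding E_def
    proof (rule sample_expect_Suc_le[OF N_pos])
      fix ss
      show "(\<Sum>S\<in>draws {..<N} beta. err (ss @ [S])) \<le> real (N ^ beta) * (C * (err ss)\<^sup>2 + err ss / 4)"
        using sum_step[of "SN_iter gradF hessF N r w0 ss"] by (simp add: err_def SN_iter_def)
    qed
    also have "\<dots> = C * sample_expect N beta k (\<lambda>ss. (err ss)\<^sup>2) + E k / 4"
      by (simp add: E_def sample_expect_eq[OF N_pos] sum.distrib add_divide_distrib
          flip: sum_distrib_left sum_divide_distrib)
    \<comment> \<open>B1 replaces the second moment by \<open>gamma\<close> times the squared mean,
      closing the recursion in \<open>E\<close> alone.\<close>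
    also have "\<dots> \<le> C * (gamma * (E k)\<^sup>2) + E k / 4"
      using B1(2) C by (intro add_right_mono mult_left_mono) (simp_all add: E_def err_def)
    finally show ?thesis by simp
  qed
  have "samples N beta 0 = {[]}" by (auto simp: samples_def)
  then have E0: "E 0 = norm (w0 - ws)"
    by (simp add: E_def sample_expect_eq[OF N_pos] err_def SN_iter_def)
  have half: "E (Suc k) \<le> E k / 2" if "C * gamma * E k \<le> 1 / 4" for k
  proof -
    have "C * gamma * (E k)\<^sup>2 \<le> 1 / 4 * E k"
      using mult_right_mono[OF that E_nonneg[of k]] by (simp add: power2_eq_square mult.assoc)
    then show ?thesis using rec[of k] by linarith
  qed
  \<comment> \<open>Smallness holds at k = 0, where the history is empty and the error
    deterministic; it persists because halving keeps \<open>E\<close> from growing.\<close>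
  have small: "C * gamma * E k \<le> 1 / 4" for k
  proof (induction k)
    case 0
    have "4 * (C * gamma * E 0) = 4 * gamma * (M / (2 * mu_b beta)) * norm (w0 - ws)"
      by (simp add: E0 C_def \<mu>_def)
    then show ?case using init(2) by linarith
  next
    case (Suc k)
    have "E (Suc k) \<le> E k" using half[OF Suc] E_nonneg[of k] by linarith
    then have "C * gamma * E (Suc k) \<le> C * gamma * E k"
      using C B1(1) by (intro mult_left_mono) simp_all
    then show ?case using Suc by linarith
  qed
  show ?thesis using half[OF small] by (simp add: E_def err_def)
qed

end
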